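(* Let $U_1,\dots,U_m\subset\mathbb{R}^n$ be closed convex sets with $\bigcap_{i=1}^mU_i\neq\varnothing$. In $\mathbb{R}^{nm}$ let $$W:=U_1\times\cdots\times U_m,\qquad D:=\{(u,u,\dots,u):u\in\mathbb{R}^n\},$$ let $R_W:=2P_W-I$, $R_D:=2P_D-I$, and for $z\in D$ let $$T_{\mathrm{CRM}}(z):=\operatorname{circ}\bigl(z,\;R_W(z),\;R_D(R_W(z))\bigr).$$ Then for all $z\in D$ and all $s\in W\cap D$, $$\|T_{\mathrm{CRM}}(z)-s\|^2\le\|z-s\|^2-\delta(z)^2,\qquad \delta(z):=\max\{\mathrm{dist}(z,W),\mathrm{dist}(z,D)\}.$$
   Context: $P_X$ denotes metric projection onto a closed convex set $X$ of $\mathbb{R}^{nm}$ (with Euclidean norm $\|\cdot\|$). $\operatorname{circ}(u,v,w)$ (the circumcenter) is the point of the affine hull of $\{u,v,w\}$ equidistant from $u$, $v$ and $w$; it is well defined for the triples occurring here, since $z\in D$ and $W\cap D\neq\varnothing$. *)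

theory Defs
  imports "HOL-Analysis.Analysis"
begin

text \<open>
  The space of dimension $nm$ is rendered as \<^typ>\<open>(real ^ 'n) ^ 'm\<close>: block vectors with
  \<open>m = CARD('m)\<close> blocks in dimension \<open>n = CARD('n)\<close>; the library norm on this type is
  the Euclidean norm of all \<open>nm\<close> coordinates.
\<close>

definition product_set :: "('m::finite \<Rightarrow> (real ^ 'n) set) \<Rightarrow> ((real ^ 'n) ^ 'm) set" where
  "product_set U = {x. \<forall>i. x $ i \<in> U i}"

definition diagonal :: "((real ^ 'n) ^ 'm) set" where
  "diagonal = {x. \<exists>u. x = (\<chi> i. u)}"

definition reflect :: "'a::euclidean_space set \<Rightarrow> 'a \<Rightarrow> 'a" where
  "reflect X x = 2 *\<^sub>R closest_point X x - x"

text \<open>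
  A definite description, hence meaningful only for triples with exactly one such point
  (it is unspecified, for instance, for three distinct collinear points).
\<close>

definition circumcenter :: "'a::euclidean_space \<Rightarrow> 'a \<Rightarrow> 'a \<Rightarrow> 'a" where
  "circumcenter u v w =
    (THE p. p \<in> affine hull {u, v, w} \<and> dist p u = dist p v \<and> dist p v = dist p w)"

definition T_CRM :: "('m::finite \<Rightarrow> (real ^ 'n) set) \<Rightarrow> (real ^ 'n) ^ 'm \<Rightarrow> (real ^ 'n) ^ 'm" where
  "T_CRM U z =
    circumcenter z (reflect (product_set U) z) (reflect diagonal (reflect (product_set U) z))"

definition delta :: "('m::finite \<Rightarrow> (real ^ 'n) set) \<Rightarrow> (real ^ 'n) ^ 'm \<Rightarrow> real" where
  "delta U z = max (infdist z (product_set U)) (infdist z diagonal)"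

end

theory Submission
  imports Defs
begin

text \<open>
  The argument takes place in the subspace \<open>D\<close>, which contains both \<open>z\<close> and \<open>s\<close>. Put
  \<open>a = P\<^sub>W z - z\<close> and let \<open>b\<close> be the orthogonal projection of \<open>a\<close> onto \<open>D\<close>. The triple defining the method is \<open>z\<close>, \<open>z + 2 a\<close>,
  \<open>z + 2 (2 b - a)\<close>; its last two points are mirror images of each other in \<open>D\<close>, so the
  circumcenter has the form \<open>z + t b\<close>, and equidistance forces \<open>t = \<parallel>a\<parallel>\<^sup>2 / \<parallel>b\<parallel>\<^sup>2 \<ge> 1\<close>
  (\<open>circumcenter_mirror_images\<close>).

  The obtuse angle property of the projection onto \<open>W\<close> gives \<open>\<parallel>a\<parallel>\<^sup>2 \<le> a \<bullet> (s - z)\<close>, and the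
  right-hand side equals \<open>b \<bullet> (s - z)\<close> because \<open>s - z\<close> lies in \<open>D\<close>. Expanding the square,
  \<open>\<parallel>z + t b - s\<parallel>\<^sup>2 \<le> \<parallel>z - s\<parallel>\<^sup>2 - 2 t \<parallel>a\<parallel>\<^sup>2 + t\<^sup>2 \<parallel>b\<parallel>\<^sup>2 = \<parallel>z - s\<parallel>\<^sup>2 - t \<parallel>a\<parallel>\<^sup>2\<close>, which is at most
  \<open>\<parallel>z - s\<parallel>\<^sup>2 - \<parallel>a\<parallel>\<^sup>2\<close>. Finally \<open>\<parallel>a\<parallel>\<close> is at least \<open>dist(z, W)\<close>, while \<open>dist(z, D) = 0\<close>.
  The inequality \<open>\<parallel>a\<parallel>\<^sup>2 \<le> b \<bullet> (s - z)\<close> also shows that \<open>b = 0\<close> forces \<open>a = 0\<close>, so the degenerate case is the trivial one where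
  the three points coincide.
\<close>

text \<open>
  The difference of two candidates lies in the span of \<open>v - u\<close> and \<open>w - u\<close>, whereas
  equidistance makes it orthogonal to both of these vectors; hence it vanishes, also when some of
  the three points coincide.
\<close>

lemma circumcenter_eqI:
  fixes c u v w :: "'a::euclidean_space"
  assumes hull: "c \<in> affine hull {u, v, w}"
    and eq: "dist c u = dist c v" "dist c v = dist c w"
  shows "circumcenter u v w = c"
  unfolding circumcenter_def
proof (rule the_equality)
  show "c \<in> affine hull {u, v, w} \<and> dist c u = dist c v \<and> dist c v = dist c w"
    using assms by blast
next
  fix p
  assume p: "p \<in> affine hull {u, v, w} \<and> dist p u = dist p v \<and> dist p v = dist p w"
  have coord: "\<exists>\<beta> \<gamma>. q = u + \<beta> *\<^sub>R (v - u) + \<gamma> *\<^sub>R (w - u)"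
    if q: "q \<in> affine hull {u, v, w}" for q
  proof -
    obtain x y t where "q = x *\<^sub>R u + y *\<^sub>R v + t *\<^sub>R w" "x + y + t = 1"
      using q unfolding affine_hull_3 by blast
    moreover from this have "x = 1 - y - t" by simp
    ultimately have "q = u + y *\<^sub>R (v - u) + t *\<^sub>R (w - u)"
      by (simp add: algebra_simps)
    then show ?thesis by blast
  qed
  have bisector: "2 * ((q - u) \<bullet> (x - u)) = (x - u) \<bullet> (x - u)"
    if q: "dist q u = dist q x" for q x :: 'a
  proof -
    have "(q - u) \<bullet> (q - u) = (q - x) \<bullet> (q - x)"
      using q by (simp add: dist_norm norm_eq)
    then show ?thesis by (simp add: algebra_simps inner_commute)
  qed
  obtain \<beta> \<gamma> \<beta>' \<gamma>' where c: "c = u + \<beta> *\<^sub>R (v - u) + \<gamma> *\<^sub>R (w - u)"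
    and pe: "p = u + \<beta>' *\<^sub>R (v - u) + \<gamma>' *\<^sub>R (w - u)"
    using coord hull p by meson
  have diff: "p - c = (\<beta>' - \<beta>) *\<^sub>R (v - u) + (\<gamma>' - \<gamma>) *\<^sub>R (w - u)"
    by (simp add: c pe algebra_simps)
  have orth: "(p - c) \<bullet> (x - u) = 0" if "x = v \<or> x = w" for x
  proof -
    have "dist p u = dist p x" "dist c u = dist c x"
      using p eq that by auto
    then have "(p - u) \<bullet> (x - u) = (c - u) \<bullet> (x - u)"
      using bisector[of p x] bisector[of c x] by linarith
    then show ?thesis by (simp add: inner_diff_left)
  qed
  have "(p - c) \<bullet> (p - c) = (\<beta>' - \<beta>) * ((p - c) \<bullet> (v - u)) + (\<gamma>' - \<gamma>) * ((p - c) \<bullet> (w - u))"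
    by (subst (2) diff) (simp only: inner_add_right inner_scaleR_right)
  also have "\<dots> = 0" using orth[of v] orth[of w] by simp
  finally show "p = c" by simp
qed

lemma closest_point_subspace_eqI:
  fixes S :: "'a::euclidean_space set"
  assumes S: "subspace S" and y: "y \<in> S" and orth: "\<And>x. x \<in> S \<Longrightarrow> (p - y) \<bullet> x = 0"
  shows "closest_point S p = y"
proof -
  have "dist p y \<le> dist p x" if x: "x \<in> S" for x
  proof -
    have "(p - y) \<bullet> (y - x) = 0"
      using orth subspace_diff[OF S y x] by blast
    then have "(norm ((p - y) + (y - x)))\<^sup>2 = (norm (p - y))\<^sup>2 + (norm (y - x))\<^sup>2"
      using norm_add_Pythagorean[of "p - y" "y - x"] by (simp only: orthogonal_def)
    then have "(norm (p - y))\<^sup>2 \<le> (norm (p - x))\<^sup>2" by simp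
    then show ?thesis by (simp add: dist_norm)
  qed
  then show ?thesis
    using closest_point_unique[OF subspace_imp_convex[OF S] closed_subspace[OF S] y] by metis
qed

text \<open>
  With \<open>a \<bullet> b = b \<bullet> b\<close>, the vector \<open>2 b - a\<close> is the mirror image of \<open>a\<close> in the line spanned by
  \<open>b\<close>. A point \<open>z + t b\<close> of the axis is therefore equidistant from the last two points, and its
  distance to \<open>z\<close> agrees with these distances exactly when \<open>t (a \<bullet> b) = a \<bullet> a\<close>, which determines
  the coefficient.
\<close>

lemma circumcenter_mirror_images:
  fixes a b z :: "'a::euclidean_space"
  assumes b: "b \<noteq> 0" and ab: "a \<bullet> b = b \<bullet> b"
  shows "circumcenter z (z + 2 *\<^sub>R a) (z + 2 *\<^sub>R (2 *\<^sub>R b - a)) = z + (a \<bullet> a / (b \<bullet> b)) *\<^sub>R b"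
proof (rule circumcenter_eqI)
  define t where "t = a \<bullet> a / (b \<bullet> b)"
  have tb: "t * (b \<bullet> b) = a \<bullet> a" using b by (simp add: t_def)
  have "z + t *\<^sub>R b = (1 - t / 2) *\<^sub>R z + (t / 4) *\<^sub>R (z + 2 *\<^sub>R a) + (t / 4) *\<^sub>R (z + 2 *\<^sub>R (2 *\<^sub>R b - a))"
  proof -
    have "(t / 4) *\<^sub>R (z + 2 *\<^sub>R a) + (t / 4) *\<^sub>R (z + 2 *\<^sub>R (2 *\<^sub>R b - a)) = (t / 2) *\<^sub>R z + t *\<^sub>R b"
      by (simp add: scaleR_add_right scaleR_diff_right flip: scaleR_add_left)
    then show ?thesis by (simp add: scaleR_diff_left add.assoc)
  qed
  moreover have "(1 - t / 2) + t / 4 + t / 4 = 1" by simp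
  ultimately show "z + (a \<bullet> a / (b \<bullet> b)) *\<^sub>R b \<in> affine hull {z, z + 2 *\<^sub>R a, z + 2 *\<^sub>R (2 *\<^sub>R b - a)}"
    unfolding affine_hull_3 t_def[symmetric] by blast
  have 1: "norm (t *\<^sub>R b - 2 *\<^sub>R a) = norm (t *\<^sub>R b)"
    unfolding norm_eq using ab tb by (simp add: inner_diff_left inner_diff_right inner_commute)
  have 2: "norm (t *\<^sub>R b - 2 *\<^sub>R (2 *\<^sub>R b - a)) = norm (t *\<^sub>R b)"
    unfolding norm_eq using ab tb by (simp add: inner_diff_left inner_diff_right inner_commute algebra_simps)
  show "dist (z + (a \<bullet> a / (b \<bullet> b)) *\<^sub>R b) z = dist (z + (a \<bullet> a / (b \<bullet> b)) *\<^sub>R b) (z + 2 *\<^sub>R a)"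
    using 1 by (simp add: dist_norm flip: t_def)
  show "dist (z + (a \<bullet> a / (b \<bullet> b)) *\<^sub>R b) (z + 2 *\<^sub>R a)
      = dist (z + (a \<bullet> a / (b \<bullet> b)) *\<^sub>R b) (z + 2 *\<^sub>R (2 *\<^sub>R b - a))"
    using 1 2 by (simp add: dist_norm flip: t_def)
qed

text \<open>
  The step \<open>t b\<close> overshoots the projection step \<open>b\<close>, as \<open>t \<ge> 1\<close>. This is harmless because the
  squared distance to \<open>s\<close> along the ray through \<open>b\<close> decreases at least until \<open>t\<close>: its minimizer
  is \<open>b \<bullet> (s - z) / (b \<bullet> b)\<close>, and the obtuse angle property bounds \<open>b \<bullet> (s - z)\<close> from below
  by \<open>a \<bullet> a\<close>.
\<close>

lemma circumcentered_reflection_decrease: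
  fixes W D :: "'a::euclidean_space set"
  assumes W: "closed W" "convex W" and D: "subspace D"
    and z: "z \<in> D" and s: "s \<in> W" "s \<in> D"
  shows "(norm (circumcenter z (reflect W z) (reflect D (reflect W z)) - s))\<^sup>2
    \<le> (norm (z - s))\<^sup>2 - (dist z (closest_point W z))\<^sup>2"
proof -
  define a where "a = closest_point W z - z"
  define b where "b = closest_point D a"
  have bD: "b \<in> D"
    unfolding b_def using closest_point_in_set[OF closed_subspace[OF D]] z by auto
  have orth: "(a - b) \<bullet> x = 0" if x: "x \<in> D" for x
  proof -
    have "(a - b) \<bullet> (x' - b) \<le> 0" if "x' \<in> D" for x'
      unfolding b_def using closest_point_dot[OF subspace_imp_convex[OF D] closed_subspace[OF D] that] .
    \<comment> \<open>In a subspace the variational inequality applies to \<open>x\<close> and to \<open>- x\<close>.\<close>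
    from this[of "b + x"] this[of "b - x"] show ?thesis
      using bD x D by (simp add: subspace_add subspace_diff)
  qed
  have RW: "reflect W z = z + 2 *\<^sub>R a"
    by (simp add: reflect_def a_def algebra_simps scaleR_2)
  have "closest_point D (z + 2 *\<^sub>R a) = z + 2 *\<^sub>R b"
  proof (rule closest_point_subspace_eqI[OF D])
    show "z + 2 *\<^sub>R b \<in> D" using D z bD by (simp add: subspace_add subspace_scale)
    show "(z + 2 *\<^sub>R a - (z + 2 *\<^sub>R b)) \<bullet> x = 0" if "x \<in> D" for x
      using orth[OF that] by (simp add: inner_diff_left)
  qed
  then have RD: "reflect D (z + 2 *\<^sub>R a) = z + 2 *\<^sub>R (2 *\<^sub>R b - a)"
    by (simp add: reflect_def algebra_simps scaleR_2)
  have "(z - closest_point W z) \<bullet> (s - closest_point W z) \<le> 0"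
    using closest_point_dot W s by blast
  then have "- a \<bullet> (s - z - a) \<le> 0"
    by (simp add: a_def)
  then have "a \<bullet> a \<le> a \<bullet> (s - z)"
    by (simp add: inner_diff_right)
  also have "\<dots> = b \<bullet> (s - z)"
    using orth[OF subspace_diff[OF D s(2) z]] by (simp add: inner_diff_left)
  finally have key: "a \<bullet> a \<le> b \<bullet> (s - z)" .
  have ab: "a \<bullet> b = b \<bullet> b"
    using orth[OF bD] by (simp add: inner_diff_left)
  have norm_a: "(dist z (closest_point W z))\<^sup>2 = a \<bullet> a"
    by (simp add: a_def dist_commute flip: power2_norm_eq_inner dist_norm)
  show ?thesis
  proof (cases "b = 0")
    case True
    then have "a \<bullet> a \<le> 0" using key by simp
    then have "a = 0" using inner_gt_zero_iff[of a] by linarith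
    have "circumcenter z z z = z" by (rule circumcenter_eqI) simp_all
    then show ?thesis
      using RW RD True \<open>a = 0\<close> norm_a by simp
  next
    case False
    define t where "t = a \<bullet> a / (b \<bullet> b)"
    have bb: "b \<bullet> b > 0" using False by simp
    have tb: "t * (b \<bullet> b) = a \<bullet> a" using False by (simp add: t_def)
    have "0 \<le> (a - b) \<bullet> (a - b)" by simp
    then have "b \<bullet> b \<le> a \<bullet> a"
      using ab by (simp add: inner_diff_left inner_diff_right inner_commute)
    then have t1: "1 \<le> t" using bb by (simp add: t_def)
    have "(norm (z + t *\<^sub>R b - s))\<^sup>2 = (norm (z - s))\<^sup>2 - 2 * t * (b \<bullet> (s - z)) + t * (t * (b \<bullet> b))"
      by (simp add: power2_norm_eq_inner algebra_simps inner_commute)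
    also have "\<dots> \<le> (norm (z - s))\<^sup>2 - 2 * t * (a \<bullet> a) + t * (a \<bullet> a)"
      using tb mult_left_mono[OF key, of "2 * t"] t1 by simp
    also have "\<dots> = (norm (z - s))\<^sup>2 - t * (a \<bullet> a)" by simp
    also have "\<dots> \<le> (norm (z - s))\<^sup>2 - a \<bullet> a"
      using mult_right_mono[OF t1, of "a \<bullet> a"] by simp
    finally show ?thesis
      using circumcenter_mirror_images[OF False ab, of z] RW RD norm_a by (simp add: t_def)
  qed
qed

lemma closed_product_set:
  assumes "\<And>i. closed (U i)"
  shows "closed (product_set U)"
proof -
  have "product_set U = (\<Inter>i. (\<lambda>x. x $ i) -` U i)"
    by (auto simp: product_set_def)
  then show ?thesis
    using assms by (auto intro!: continuous_intros)
qed

lemma convex_product_set: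
  assumes "\<And>i. convex (U i)"
  shows "convex (product_set U)"
  using assms by (auto simp: product_set_def convex_def)

lemma subspace_diagonal: "subspace (diagonal :: ((real ^ 'n) ^ 'm) set)"
proof -
  have "linear (\<lambda>u. (\<chi> i. u) :: (real ^ 'n) ^ 'm)"
    by (rule linearI) (simp_all add: vec_eq_iff)
  moreover have "diagonal = range (\<lambda>u. (\<chi> i. u) :: (real ^ 'n) ^ 'm)"
    by (auto simp: diagonal_def)
  ultimately show ?thesis using linear_subspace_image subspace_UNIV by metis
qed

theorem mainTheorem9:
  fixes U :: "'m::finite \<Rightarrow> (real ^ 'n) set"
  assumes "\<And>i. closed (U i)"
    and "\<And>i. convex (U i)"
    and "(\<Inter>i. U i) \<noteq> {}"
  shows "\<forall>z \<in> diagonal. \<forall>s \<in> product_set U \<inter> diagonal.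
    (norm (T_CRM U z - s))\<^sup>2 \<le> (norm (z - s))\<^sup>2 - (delta U z)\<^sup>2"
proof (intro ballI)
  fix z s
  assume z: "z \<in> (diagonal :: ((real ^ 'n) ^ 'm) set)" and s: "s \<in> product_set U \<inter> diagonal"
  have W: "closed (product_set U)" "convex (product_set U)"
    using assms closed_product_set convex_product_set by blast+
  have "infdist z (product_set U) \<le> dist z (closest_point (product_set U) z)"
    using W s by (intro infdist_le closest_point_in_set) auto
  then have "(delta U z)\<^sup>2 \<le> (dist z (closest_point (product_set U) z))\<^sup>2"
    using z by (intro power_mono) (auto simp: delta_def infdist_nonneg le_max_iff_disj)
  moreover have "(norm (T_CRM U z - s))\<^sup>2
      \<le> (norm (z - s))\<^sup>2 - (dist z (closest_point (product_set U) z))\<^sup>2"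
    unfolding T_CRM_def
    using circumcentered_reflection_decrease[OF W subspace_diagonal z] s by blast
  ultimately show "(norm (T_CRM U z - s))\<^sup>2 \<le> (norm (z - s))\<^sup>2 - (delta U z)\<^sup>2"
    by linarith
qed

end
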